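(* Let $\varepsilon,\lambda,\mu\in\mathbb{R}$, let $u=u(t,x,y)$ be a solution of $$\mathcal{D}(u_t)=\mathrm{J}(u,\mathcal{D}(u)),\qquad(\ast)$$ and let $s=s(t,x,y)$ be a solution of the system $$s_t=\mathrm{J}(u,s)+\varepsilon\,\mathrm{E}(u),\qquad \mathrm{J}(\mathcal{D}(u),s)=\lambda+\mu\,\mathcal{D}(u)-\varepsilon\,\mathrm{E}(\mathcal{D}(u)).$$ Put $$p_0=s-\lambda\,t\,x\,y-(\mu+2\varepsilon)\,t\,u,$$ and let $q$ be any one of the functions $$\varphi_1=-t\,u_t-u,\quad \varphi_2=-u_t,\quad \varphi_3=-x\,u_x+y\,u_y,\quad \varphi_4=-t\,x\,u_x+t\,y\,u_y+x\,y,\quad \varphi_5=-x\,u_x-y\,u_y+2u,$$ $$\varphi_6(A)=-A(t)\,u_x+A'(t)\,y,\quad \varphi_7(A)=-A(t)\,u_y-A'(t)\,x,\quad \varphi_8(A)=A(t),$$ where $A$ is an arbitrary smooth function of $t$. Then the 2-form $\Omega_{q,p_0}$, obtained by setting $p=p_0$ in $$\Omega_{q,p}=\mathcal{D}(q)\,p\;dx\wedge dy+K_1\,dy\wedge dt+K_2\,dt\wedge dx,$$ $$K_1=u_y\,(q\,\mathcal{D}(p)+\mathcal{D}(q)\,p)-\mathcal{D}(u_y)\,q\,p-\tfrac12\,(q_t\,p)_y-q_y\,(p_t-u_x\,p_y)+u_{yy}\,q\,p_x,$$ $$K_2=-u_x\,(q\,\mathcal{D}(p)+\mathcal{D}(q)\,p)+\mathcal{D}(u_x)\,q\,p+\tfrac12\,(q_t\,p)_x+q\,(p_{tx}-u_{xx}\,p_y)-u_y\,q_x\,p_x,$$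 is closed; that is, each $\Omega_{\varphi_i,p_0}$, $i=1,\dots,8$, is a (nonlocal) conservation law of equation $(\ast)$: $$\partial_t\big(\mathcal{D}(q)\,p_0\big)+\partial_x\big(K_1|_{p=p_0}\big)+\partial_y\big(K_2|_{p=p_0}\big)=0 .$$
   Context: All functions are smooth functions of the independent variables $(t,x,y)$ on an open set (all considerations are local); subscripts denote partial derivatives. Notation: $\mathcal{D}(a)=a_{xy}$; $\mathrm{J}(a,b)=a_x b_y-a_y b_x$; $\mathrm{E}(a)=x\,a_x+y\,a_y-2a$. Equation $(\ast)$ is the form taken by the two-dimensional Euler equation in vorticity form after a complex linear change of the variables $x,y$. The conservation law is called nonlocal because its coefficients depend on the function $s$ (a pseudopotential of a differential covering of $(\ast)$) and its derivatives, in addition to $t,x,y,u$ and the derivatives of $u$. *)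

theory Defs
  imports "HOL-Analysis.Analysis"
begin

section \<open>Smooth functions on open sets\<close>

text \<open>\<open>C_on k S f\<close>: on the open set \<open>S\<close>, all iterated directional derivatives of \<open>f\<close> of order
  at most \<open>k\<close> exist (as values of Frechet derivatives) and are continuous.\<close>

primrec C_on :: "nat \<Rightarrow> 'a::real_normed_vector set \<Rightarrow> ('a \<Rightarrow> 'b::real_normed_vector) \<Rightarrow> bool" where
  "C_on 0 S f \<longleftrightarrow> continuous_on S f"
| "C_on (Suc k) S f \<longleftrightarrow>
     (\<forall>z\<in>S. f differentiable (at z)) \<and> (\<forall>v. C_on k S (\<lambda>z. frechet_derivative f (at z) v))"

definition smooth_on :: "'a::real_normed_vector set \<Rightarrow> ('a \<Rightarrow> 'b::real_normed_vector) \<Rightarrow> bool" where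
  "smooth_on S f \<longleftrightarrow> (\<forall>k. C_on k S f)"


section \<open>Partial derivatives and the operators D, J, E\<close>

text \<open>Points are triples \<open>(t, x, y)\<close>.\<close>

type_synonym point = "real \<times> real \<times> real"
type_synonym scalar_field = "point \<Rightarrow> real"

definition Dt :: "scalar_field \<Rightarrow> scalar_field" where
  "Dt f = (\<lambda>(t, x, y). deriv (\<lambda>r. f (r, x, y)) t)"

definition Dx :: "scalar_field \<Rightarrow> scalar_field" where
  "Dx f = (\<lambda>(t, x, y). deriv (\<lambda>r. f (t, r, y)) x)"

definition Dy :: "scalar_field \<Rightarrow> scalar_field" where
  "Dy f = (\<lambda>(t, x, y). deriv (\<lambda>r. f (t, x, r)) y)"

definition DD :: "scalar_field \<Rightarrow> scalar_field" where
  "DD a = Dy (Dx a)"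

definition JJ :: "scalar_field \<Rightarrow> scalar_field \<Rightarrow> scalar_field" where
  "JJ a b = (\<lambda>z. Dx a z * Dy b z - Dy a z * Dx b z)"

definition EE :: "scalar_field \<Rightarrow> scalar_field" where
  "EE a = (\<lambda>(t, x, y). x * Dx a (t, x, y) + y * Dy a (t, x, y) - 2 * a (t, x, y))"


section \<open>The equation and its covering\<close>

definition euler_eq :: "point set \<Rightarrow> scalar_field \<Rightarrow> bool" where
  "euler_eq S u \<longleftrightarrow> (\<forall>z\<in>S. DD (Dt u) z = JJ u (DD u) z)"

definition covering_eqs ::
  "point set \<Rightarrow> real \<Rightarrow> real \<Rightarrow> real \<Rightarrow> scalar_field \<Rightarrow> scalar_field \<Rightarrow> bool" where
  "covering_eqs S \<epsilon> l \<mu> u s \<longleftrightarrow>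
     (\<forall>z\<in>S. Dt s z = JJ u s z + \<epsilon> * EE u z) \<and>
     (\<forall>z\<in>S. JJ (DD u) s z = l + \<mu> * DD u z - \<epsilon> * EE (DD u) z)"

definition p0 :: "real \<Rightarrow> real \<Rightarrow> real \<Rightarrow> scalar_field \<Rightarrow> scalar_field \<Rightarrow> scalar_field" where
  "p0 \<epsilon> l \<mu> u s = (\<lambda>(t, x, y). s (t, x, y) - l * t * x * y - (\<mu> + 2 * \<epsilon>) * t * u (t, x, y))"


section \<open>The functions \<open>\<phi>\<^sub>1, \<dots>, \<phi>\<^sub>8\<close>\<close>

definition phi1 :: "scalar_field \<Rightarrow> scalar_field" where
  "phi1 u = (\<lambda>(t, x, y). - t * Dt u (t, x, y) - u (t, x, y))"

definition phi2 :: "scalar_field \<Rightarrow> scalar_field" where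
  "phi2 u = (\<lambda>z. - Dt u z)"

definition phi3 :: "scalar_field \<Rightarrow> scalar_field" where
  "phi3 u = (\<lambda>(t, x, y). - x * Dx u (t, x, y) + y * Dy u (t, x, y))"

definition phi4 :: "scalar_field \<Rightarrow> scalar_field" where
  "phi4 u = (\<lambda>(t, x, y). - t * x * Dx u (t, x, y) + t * y * Dy u (t, x, y) + x * y)"

definition phi5 :: "scalar_field \<Rightarrow> scalar_field" where
  "phi5 u = (\<lambda>(t, x, y). - x * Dx u (t, x, y) - y * Dy u (t, x, y) + 2 * u (t, x, y))"

definition phi6 :: "(real \<Rightarrow> real) \<Rightarrow> scalar_field \<Rightarrow> scalar_field" where
  "phi6 A u = (\<lambda>(t, x, y). - A t * Dx u (t, x, y) + deriv A t * y)"

definition phi7 :: "(real \<Rightarrow> real) \<Rightarrow> scalar_field \<Rightarrow> scalar_field" where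
  "phi7 A u = (\<lambda>(t, x, y). - A t * Dy u (t, x, y) - deriv A t * x)"

definition phi8 :: "(real \<Rightarrow> real) \<Rightarrow> scalar_field" where
  "phi8 A = (\<lambda>(t, x, y). A t)"


section \<open>Differential 2-forms in the coordinates t, x, y\<close>

text \<open>A differential form is given by its values on tangent vectors; tangent vectors at every point
  are identified with elements of \<^typ>\<open>point\<close>.\<close>

type_synonym form1 = "point \<Rightarrow> point \<Rightarrow> real"
type_synonym form2 = "point \<Rightarrow> point \<Rightarrow> point \<Rightarrow> real"
type_synonym form3 = "point \<Rightarrow> point \<Rightarrow> point \<Rightarrow> point \<Rightarrow> real"

definition dt :: form1 where "dt z v = fst v"
definition dx :: form1 where "dx z v = fst (snd v)"
definition dy :: form1 where "dy z v = snd (snd v)"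

definition wedge :: "form1 \<Rightarrow> form1 \<Rightarrow> form2" where
  "wedge \<alpha> \<beta> z v w = \<alpha> z v * \<beta> z w - \<alpha> z w * \<beta> z v"

text \<open>The invariant formula for the exterior derivative, evaluated on constant vector fields
  (whose Lie brackets vanish).\<close>

definition ext_deriv :: "form2 \<Rightarrow> form3" where
  "ext_deriv \<omega> z v\<^sub>0 v\<^sub>1 v\<^sub>2 =
     frechet_derivative (\<lambda>z. \<omega> z v\<^sub>1 v\<^sub>2) (at z) v\<^sub>0
   - frechet_derivative (\<lambda>z. \<omega> z v\<^sub>0 v\<^sub>2) (at z) v\<^sub>1
   + frechet_derivative (\<lambda>z. \<omega> z v\<^sub>0 v\<^sub>1) (at z) v\<^sub>2"

definition closed_form :: "point set \<Rightarrow> form2 \<Rightarrow> bool" where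
  "closed_form S \<omega> \<longleftrightarrow> (\<forall>z\<in>S. \<forall>v\<^sub>0 v\<^sub>1 v\<^sub>2. ext_deriv \<omega> z v\<^sub>0 v\<^sub>1 v\<^sub>2 = 0)"


section \<open>The 2-form \<open>\<Omega>\<^bsub>q,p\<^esub>\<close>\<close>

definition K1 :: "scalar_field \<Rightarrow> scalar_field \<Rightarrow> scalar_field \<Rightarrow> scalar_field" where
  "K1 u q p = (\<lambda>z.
       Dy u z * (q z * DD p z + DD q z * p z)
     - DD (Dy u) z * q z * p z
     - 1/2 * Dy (\<lambda>w. Dt q w * p w) z
     - Dy q z * (Dt p z - Dx u z * Dy p z)
     + Dy (Dy u) z * q z * Dx p z)"

definition K2 :: "scalar_field \<Rightarrow> scalar_field \<Rightarrow> scalar_field \<Rightarrow> scalar_field" where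
  "K2 u q p = (\<lambda>z.
     - Dx u z * (q z * DD p z + DD q z * p z)
     + DD (Dx u) z * q z * p z
     + 1/2 * Dx (\<lambda>w. Dt q w * p w) z
     + q z * (Dx (Dt p) z - Dx (Dx u) z * Dy p z)
     - Dy u z * Dx q z * Dx p z)"

definition Omega :: "scalar_field \<Rightarrow> scalar_field \<Rightarrow> scalar_field \<Rightarrow> form2" where
  "Omega u q p z v w =
       DD q z * p z * wedge dx dy z v w
     + K1 u q p z * wedge dy dt z v w
     + K2 u q p z * wedge dt dx z v w"

end

theory Submission
  imports Defs
begin

text \<open>The operator linearised u is the linearisation of the Euler equation at u and adjoint_linearised u
  its formal adjoint. For arbitrary q and p, dOmega = (p * linearised u q + q * adjoint_linearised u p) dt dx dy
  is an identity that uses only the symmetry of mixed partial derivatives. Each phi_i is a symmetry of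
  the Euler equation, so linearised u phi_i = 0. Applying D to the first covering equation and inserting
  the second one gives adjoint_linearised u s = l + (mu + 2 epsilon) D(u), and the two correction terms
  in p0 contribute exactly the negatives of these two summands.\<close>

section \<open>Smooth functions\<close>

text \<open>A name for the expression under the quantifier in \<open>C_on\<close>: as an operator on
  functions it can be iterated and matched by rewriting.\<close>

definition pd :: "'a::real_normed_vector \<Rightarrow> ('a \<Rightarrow> 'b::real_normed_vector) \<Rightarrow> 'a \<Rightarrow> 'b" where
  "pd v f = (\<lambda>z. frechet_derivative f (at z) v)"

lemma pd_eqI: "(f has_derivative f') (at z) \<Longrightarrow> pd v f z = f' v"
  unfolding pd_def using frechet_derivative_at by metis

text \<open>On an open set the two functions agree near \<open>z\<close>, so they have the same
  derivative candidates, and \<open>frechet_derivative\<close> is a choice among these. The equality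
  therefore holds even where no derivative exists.\<close>

lemma pd_cong:
  assumes "open S" "z \<in> S" "\<And>w. w \<in> S \<Longrightarrow> f w = g w"
  shows "pd v f z = pd v g z"
proof -
  have "(f has_derivative F) (at z) \<longleftrightarrow> (g has_derivative F) (at z)" for F
    using assms has_derivative_transform_within_open[of f F z UNIV S g]
      has_derivative_transform_within_open[of g F z UNIV S f] by auto
  then show ?thesis by (simp add: pd_def frechet_derivative_def)
qed

text \<open>The sum, product and chain rules compute \<open>pd v\<close> only at points of
  \<open>S\<close>; this lemma lets such local formulas replace the derivative inside
  \<open>C_on\<close>.\<close>

lemma C_on_cong:
  assumes "open S" "\<And>w. w \<in> S \<Longrightarrow> f w = g w"
  shows "C_on k S f \<longleftrightarrow> C_on k S g"
  using assms(2)
proof (induction k arbitrary: f g)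
  case 0
  then show ?case by (simp cong: continuous_on_cong)
next
  case (Suc k)
  have "f differentiable (at z) \<longleftrightarrow> g differentiable (at z)" if "z \<in> S" for z
    unfolding differentiable_def
    using that assms(1) Suc.prems has_derivative_transform_within_open[of f _ z UNIV S g]
      has_derivative_transform_within_open[of g _ z UNIV S f] by metis
  moreover have "C_on k S (pd v f) \<longleftrightarrow> C_on k S (pd v g)" for v
    by (rule Suc.IH) (rule pd_cong[OF assms(1) _ Suc.prems])
  ultimately show ?case by (auto simp: pd_def)
qed

lemma C_on_Suc_pd:
  "C_on (Suc k) S f \<longleftrightarrow> (\<forall>z\<in>S. f differentiable (at z)) \<and> (\<forall>v. C_on k S (pd v f))"
  by (simp add: pd_def)

lemma C_on_SucD: "C_on (Suc k) S f \<Longrightarrow> C_on k S f"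
proof (induction k arbitrary: f)
  case 0
  then show ?case
    by (simp add: continuous_at_imp_continuous_on differentiable_imp_continuous_within)
next
  case (Suc k)
  then show ?case unfolding C_on_Suc_pd[of "Suc k"] C_on_Suc_pd[of k] by blast
qed

section \<open>Closure of the classes \<open>C_on\<close> under algebra and linear
  substitution\<close>

lemma C_on_const: "C_on k S (\<lambda>z. c)"
  by (induction k arbitrary: c) auto

lemma C_on_bounded_linear:
  assumes "bounded_linear f" shows "C_on k S f"
proof (cases k)
  case 0
  then show ?thesis using assms by (simp add: linear_continuous_on)
next
  case (Suc n)
  have "pd v f = (\<lambda>z. f v)" for v
    using pd_eqI bounded_linear_imp_has_derivative[OF assms] by blast
  then show ?thesis
    unfolding Suc C_on_Suc_pd using assms bounded_linear_imp_differentiable[OF assms] by (simp add: C_on_const)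
qed

lemma pd_add:
  "f differentiable (at z) \<Longrightarrow> g differentiable (at z) \<Longrightarrow> pd v (\<lambda>w. f w + g w) z = pd v f z + pd v g z"
  by (rule pd_eqI[THEN trans, OF has_derivative_add])
    (auto simp: frechet_derivative_works[symmetric] pd_def)

lemma pd_mult:
  fixes f g :: "'a::real_normed_vector \<Rightarrow> real"
  shows "f differentiable (at z) \<Longrightarrow> g differentiable (at z) \<Longrightarrow>
    pd v (\<lambda>w. f w * g w) z = f z * pd v g z + pd v f z * g z"
  by (rule pd_eqI[THEN trans, OF has_derivative_mult])
    (auto simp: frechet_derivative_works[symmetric] pd_def)

lemma C_on_add:
  assumes "open S" "C_on k S f" "C_on k S g"
  shows "C_on k S (\<lambda>z. f z + g z)"
  using assms(2,3)
proof (induction k arbitrary: f g)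
  case 0
  then show ?case by (simp add: continuous_on_add)
next
  case (Suc k)
  then have "C_on k S (pd v (\<lambda>w. f w + g w)) \<longleftrightarrow> C_on k S (\<lambda>z. pd v f z + pd v g z)" for v
    by (intro C_on_cong[OF assms(1)] pd_add) auto
  with Suc show ?case unfolding C_on_Suc_pd by auto
qed

lemma C_on_mult:
  fixes f g :: "'a::real_normed_vector \<Rightarrow> real"
  assumes "open S" "C_on k S f" "C_on k S g"
  shows "C_on k S (\<lambda>z. f z * g z)"
  using assms(2,3)
proof (induction k arbitrary: f g)
  case 0
  then show ?case by (simp add: continuous_on_mult)
next
  case (Suc k)
  then have "C_on k S (pd v (\<lambda>w. f w * g w)) \<longleftrightarrow> C_on k S (\<lambda>z. f z * pd v g z + pd v f z * g z)" for v
    by (intro C_on_cong[OF assms(1)] pd_mult) auto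
  \<comment> \<open>In the Leibniz formula one factor stays undifferentiated and has order
    \<open>Suc k\<close>; \<open>C_on_SucD\<close> lowers it to \<open>k\<close> so that the
    induction hypothesis applies.\<close>
  moreover have "C_on k S (\<lambda>z. f z * pd v g z + pd v f z * g z)" for v
    using Suc.prems[THEN C_on_SucD] Suc.prems unfolding C_on_Suc_pd
    by (intro C_on_add[OF assms(1)] Suc.IH) auto
  ultimately show ?case using Suc.prems unfolding C_on_Suc_pd by auto
qed

text \<open>The inner map has constant derivative, so each directional derivative of the composite
  is again a composite with \<open>L\<close>, and the induction closes.\<close>

lemma C_on_compose_bounded_linear:
  assumes "open S" "bounded_linear L" "C_on k (L ` S) f"
  shows "C_on k S (\<lambda>z. f (L z))"
  using assms(3)
proof (induction k arbitrary: f)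
  case 0
  then show ?case
    using continuous_on_compose2[OF _ linear_continuous_on[OF assms(2)], of "L ` S" f S] by auto
next
  case (Suc k)
  have *: "((\<lambda>z. f (L z)) has_derivative (\<lambda>v. pd (L v) f (L z))) (at z)" if "z \<in> S" for z
  proof -
    have "f differentiable (at (L z))" using Suc.prems that by auto
    then have "(f has_derivative (\<lambda>v. pd v f (L z))) (at (L z))"
      by (simp add: pd_def frechet_derivative_works)
    from has_derivative_compose[OF bounded_linear_imp_has_derivative[OF assms(2)] this]
    show ?thesis by simp
  qed
  then have "C_on k S (pd v (\<lambda>z. f (L z))) \<longleftrightarrow> C_on k S (\<lambda>z. pd (L v) f (L z))" for v
    by (intro C_on_cong[OF assms(1)] pd_eqI)
  moreover have "C_on k S (\<lambda>z. pd (L v) f (L z))" for v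
    using Suc.prems unfolding C_on_Suc_pd by (intro Suc.IH) auto
  ultimately show ?case unfolding C_on_Suc_pd using * by (auto simp: differentiable_def)
qed

lemma smooth_on_differentiable: "smooth_on S f \<Longrightarrow> z \<in> S \<Longrightarrow> f differentiable (at z)"
  unfolding smooth_on_def by (metis C_on_Suc_pd)

lemma smooth_on_has_derivative:
  "smooth_on S f \<Longrightarrow> z \<in> S \<Longrightarrow> (f has_derivative (\<lambda>v. pd v f z)) (at z)"
  using smooth_on_differentiable[of S f z] unfolding frechet_derivative_works pd_def .

lemma smooth_on_pd: "smooth_on S f \<Longrightarrow> smooth_on S (pd v f)"
  unfolding smooth_on_def using C_on_Suc_pd by metis

lemma smooth_on_continuous: "smooth_on S f \<Longrightarrow> continuous_on S f"
  unfolding smooth_on_def by (metis C_on.simps(1))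

text \<open>The second difference is symmetric in \<open>a\<close> and \<open>b\<close>, so uniqueness of limits yields Schwarz' theorem.\<close>

lemma second_difference_tendsto:
  fixes f :: "'a::real_normed_vector \<Rightarrow> real"
  assumes "open S" "smooth_on S f" "z \<in> S"
  shows "((\<lambda>h. (f (z + h *\<^sub>R a + h *\<^sub>R b) - f (z + h *\<^sub>R a) - f (z + h *\<^sub>R b) + f z) / h\<^sup>2)
           \<longlongrightarrow> pd b (pd a f) z) (at_right 0)"
proof (rule tendstoI)
  fix e :: real assume "e > 0"
  have "continuous (at z) (pd b (pd a f))"
    using assms smooth_on_continuous smooth_on_pd continuous_on_eq_continuous_at by metis
  then obtain d1 where d1: "d1 > 0" "\<And>w. dist w z < d1 \<Longrightarrow> dist (pd b (pd a f) w) (pd b (pd a f) z) < e"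
    using \<open>e > 0\<close> unfolding continuous_at_eps_delta by metis
  obtain d2 where d2: "d2 > 0" "ball z d2 \<subseteq> S"
    using assms open_contains_ball by blast
  define d where "d = min d1 d2"
  \<comment> \<open>The summand 1 keeps \<open>N\<close> positive when \<open>a\<close> and
    \<open>b\<close> both vanish and makes the estimate by \<open>h * N\<close> strict.\<close>
  define N where "N = norm a + norm b + 1"
  have "d > 0" "N > 0" using d1 d2 by (auto simp: d_def N_def add_nonneg_pos)
  have near: "dist (z + r *\<^sub>R a + t *\<^sub>R b) z < d" if "0 \<le> r" "r \<le> h" "0 \<le> t" "t \<le> h" "0 < h" "h < d / N" for r t h
  proof -
    have "dist (z + r *\<^sub>R a + t *\<^sub>R b) z \<le> norm (r *\<^sub>R a) + norm (t *\<^sub>R b)"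
      by (simp add: dist_norm algebra_simps) (metis norm_triangle_ineq norm_scaleR)
    also have "\<dots> \<le> h * norm a + h * norm b"
      using that by (intro add_mono) (auto intro: mult_right_mono)
    also have "\<dots> < h * N" using that by (simp add: N_def algebra_simps)
    also have "\<dots> < d" using that \<open>N > 0\<close> by (simp add: field_simps)
    finally show ?thesis .
  qed
  have inS: "z + r *\<^sub>R a + t *\<^sub>R b \<in> S" if "0 \<le> r" "r \<le> h" "0 \<le> t" "t \<le> h" "0 < h" "h < d / N" for r t h
    using near[OF that] d2 by (auto simp: d_def dist_commute)
  have "dist ((f (z + h *\<^sub>R a + h *\<^sub>R b) - f (z + h *\<^sub>R a) - f (z + h *\<^sub>R b) + f z) / h\<^sup>2)
       (pd b (pd a f) z) < e" if h: "0 < h" "h < d / N" for h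
  proof -
    \<comment> \<open>The directions are bound afresh because the fact serves twice: for
      \<open>f\<close> along the outer \<open>a\<close>, then for \<open>pd a f\<close> along the
      outer \<open>b\<close>.\<close>
    have der_r: "((\<lambda>r. g (z + r *\<^sub>R a + t *\<^sub>R b)) has_real_derivative pd a g (z + r *\<^sub>R a + t *\<^sub>R b)) (at r)"
      if "smooth_on S g" "z + r *\<^sub>R a + t *\<^sub>R b \<in> S" for g r t and a b :: 'a
    proof -
      note D = smooth_on_has_derivative[OF that]
      have "((\<lambda>r. z + r *\<^sub>R a + t *\<^sub>R b) has_derivative (\<lambda>k. k *\<^sub>R a)) (at r)"
        by (auto intro!: derivative_eq_intros)
      from has_derivative_compose[OF this D] 
      have "((\<lambda>r. g (z + r *\<^sub>R a + t *\<^sub>R b)) has_derivative (\<lambda>k. pd (k *\<^sub>R a) g (z + r *\<^sub>R a + t *\<^sub>R b))) (at r)" .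
      moreover have "(\<lambda>k. pd (k *\<^sub>R a) g (z + r *\<^sub>R a + t *\<^sub>R b)) = (*) (pd a g (z + r *\<^sub>R a + t *\<^sub>R b))"
        using linear_scale[OF has_derivative_linear[OF D]] by (auto simp: mult.commute)
      ultimately show ?thesis by (simp add: has_field_derivative_def)
    qed
    have "\<exists>r. 0 < r \<and> r < h \<and>
        (f (z + h *\<^sub>R a + h *\<^sub>R b) - f (z + h *\<^sub>R a + 0 *\<^sub>R b)) - (f (z + 0 *\<^sub>R a + h *\<^sub>R b) - f (z + 0 *\<^sub>R a + 0 *\<^sub>R b))
        = (h - 0) * (pd a f (z + r *\<^sub>R a + h *\<^sub>R b) - pd a f (z + r *\<^sub>R a + 0 *\<^sub>R b))"
      by (rule MVT2[of 0 h "\<lambda>r. f (z + r *\<^sub>R a + h *\<^sub>R b) - f (z + r *\<^sub>R a + 0 *\<^sub>R b)"], use h in simp)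
        (intro DERIV_diff der_r assms inS[of _ h]; use h in simp)+
    then obtain r where r: "0 < r" "r < h" and
      1: "f (z + h *\<^sub>R a + h *\<^sub>R b) - f (z + h *\<^sub>R a) - f (z + h *\<^sub>R b) + f z
        = h * (pd a f (z + r *\<^sub>R a + h *\<^sub>R b) - pd a f (z + r *\<^sub>R a))"
      by auto
    \<comment> \<open>The second mean value argument varies \<open>t\<close> instead of
      \<open>r\<close>; the moving term is put first to match \<open>der_r\<close>. Afterwards the
      difference quotient equals the mixed derivative at an intermediate point.\<close>
    have sw: "z + r *\<^sub>R a + t *\<^sub>R b = z + t *\<^sub>R b + r *\<^sub>R a" for t by simp
    have "\<exists>t. 0 < t \<and> t < h \<and>
        pd a f (z + r *\<^sub>R a + h *\<^sub>R b) - pd a f (z + r *\<^sub>R a + 0 *\<^sub>R b)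
        = (h - 0) * pd b (pd a f) (z + r *\<^sub>R a + t *\<^sub>R b)"
      unfolding sw
      by (rule MVT2[of 0 h "\<lambda>t. pd a f (z + t *\<^sub>R b + r *\<^sub>R a)"], use h in simp)
        (intro der_r smooth_on_pd assms inS[of _ h, unfolded sw]; use h r inS[of r h, unfolded sw] in simp)
    then obtain t where t: "0 < t" "t < h" and
      2: "pd a f (z + r *\<^sub>R a + h *\<^sub>R b) - pd a f (z + r *\<^sub>R a) = h * pd b (pd a f) (z + r *\<^sub>R a + t *\<^sub>R b)"
      by auto
    have "dist (z + r *\<^sub>R a + t *\<^sub>R b) z < d1"
      using near[of r h t] r t h by (simp add: d_def)
    from d1(2)[OF this] show ?thesis
      using h unfolding 1 2 by (simp add: power2_eq_square)
  qed
  then show "\<forall>\<^sub>F h in at_right 0. dist ((f (z + h *\<^sub>R a + h *\<^sub>R b) - f (z + h *\<^sub>R a) - f (z + h *\<^sub>R b) + f z) / h\<^sup>2)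
       (pd b (pd a f) z) < e"
    using \<open>d > 0\<close> \<open>N > 0\<close> unfolding eventually_at_right_field
    by (intro exI[of _ "d / N"]) auto
qed

lemma pd_commute:
  fixes f :: "'a::real_normed_vector \<Rightarrow> real"
  assumes "open S" "smooth_on S f" "z \<in> S"
  shows "pd a (pd b f) z = pd b (pd a f) z"
proof (rule tendsto_unique)
  show "((\<lambda>h. (f (z + h *\<^sub>R a + h *\<^sub>R b) - f (z + h *\<^sub>R a) - f (z + h *\<^sub>R b) + f z) / h\<^sup>2)
           \<longlongrightarrow> pd a (pd b f) z) (at_right 0)"
    using second_difference_tendsto[OF assms, of b a] by (simp add: algebra_simps)
qed (use second_difference_tendsto[OF assms, of a b] in auto)

section \<open>The linearised equation and its adjoint\<close>

definition linearised :: "scalar_field \<Rightarrow> scalar_field \<Rightarrow> scalar_field" where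
  "linearised u q = (\<lambda>z. DD (Dt q) z - JJ q (DD u) z - JJ u (DD q) z)"

text \<open>Three integrations by parts turn p D(q_t) into -q D(p_t), so the formal adjoint L* of L
  = \<open>linearised u\<close> is, in sign, the negative of this operator. With this choice p L(q)
  - q L*(p) becomes the sum in \<open>divergence\<close>.\<close>

definition adjoint_linearised :: "scalar_field \<Rightarrow> scalar_field \<Rightarrow> scalar_field" where
  "adjoint_linearised u p = (\<lambda>z. DD (Dt p) z - DD (JJ u p) z + JJ (DD u) p z)"

section \<open>Calculus on the domain\<close>

locale open_domain =
  fixes S :: "point set"
  assumes open_S: "open S"
begin

lemma smooth_add: "smooth_on S f \<Longrightarrow> smooth_on S g \<Longrightarrow> smooth_on S (\<lambda>z. f z + g z)" for f g :: scalar_field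
  using C_on_add[OF open_S] unfolding smooth_on_def by blast

lemma smooth_mult: "smooth_on S f \<Longrightarrow> smooth_on S g \<Longrightarrow> smooth_on S (\<lambda>z. f z * g z)" for f g :: scalar_field
  using C_on_mult[OF open_S] unfolding smooth_on_def by blast

lemma smooth_const: "smooth_on S (\<lambda>z. c)" for c :: real
  using C_on_const unfolding smooth_on_def by blast

lemma smooth_uminus: "smooth_on S f \<Longrightarrow> smooth_on S (\<lambda>z. - f z)" for f :: scalar_field
  using smooth_mult[OF smooth_const[of "-1"]] by simp

lemma smooth_diff: "smooth_on S f \<Longrightarrow> smooth_on S g \<Longrightarrow> smooth_on S (\<lambda>z. f z - g z)" for f g :: scalar_field
  using smooth_add[OF _ smooth_uminus] by simp

lemma smooth_divide: "smooth_on S f \<Longrightarrow> smooth_on S (\<lambda>z. f z / c)" for f :: scalar_field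
  using smooth_mult[OF _ smooth_const[of "inverse c"]] by (simp add: divide_inverse)

lemma smooth_coord:
  "smooth_on S (\<lambda>z. fst z)" "smooth_on S (\<lambda>z. fst (snd z))" "smooth_on S (\<lambda>z. snd (snd z))"
  unfolding smooth_on_def by (intro allI C_on_bounded_linear bounded_linear_intros)+

lemma smooth_of_time: "smooth_on (fst ` S) B \<Longrightarrow> smooth_on S (\<lambda>z. B (fst z))" for B :: "real \<Rightarrow> real"
  using C_on_compose_bounded_linear[OF open_S bounded_linear_fst] unfolding smooth_on_def by blast

lemma open_fst_image: "open (fst ` S)"
  using open_S by (rule open_image_fst)

text \<open>Needed for the factor \<open>deriv A\<close> in \<open>phi6\<close> and
  \<open>phi7\<close>. The projection of \<open>S\<close> is open, and on it \<open>deriv B\<close>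
  is the derivative of \<open>B\<close> in direction 1.\<close>

lemma smooth_deriv: "smooth_on (fst ` S) B \<Longrightarrow> smooth_on (fst ` S) (deriv B)" for B :: "real \<Rightarrow> real"
proof -
  assume B: "smooth_on (fst ` S) B"
  have "C_on k (fst ` S) (deriv B) \<longleftrightarrow> C_on k (fst ` S) (pd 1 B)" for k
  proof (rule C_on_cong[OF open_fst_image])
    fix t assume "t \<in> fst ` S"
    then have "(B has_derivative (\<lambda>v. pd v B t)) (at t)"
      using B smooth_on_has_derivative by blast
    moreover have "(\<lambda>v. pd v B t) = (*) (pd 1 B t)"
    proof
      fix v :: real
      show "pd v B t = pd 1 B t * v"
        using linear_scale[OF has_derivative_linear[OF calculation], of v 1]
        unfolding real_scaleR_def mult_1_right by (rule trans) (rule mult.commute)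
    qed
    ultimately show "deriv B t = pd 1 B t"
      using DERIV_imp_deriv[of B "pd 1 B t" t] unfolding has_field_derivative_def by metis
  qed
  with smooth_on_pd[OF B, of 1] show ?thesis unfolding smooth_on_def by blast
qed

lemmas smooth_rules = smooth_add smooth_mult smooth_const smooth_uminus smooth_diff smooth_divide smooth_coord
  smooth_of_time smooth_deriv smooth_on_pd

lemma pd_sum: "z \<in> S \<Longrightarrow> smooth_on S f \<Longrightarrow> smooth_on S g \<Longrightarrow>
    pd v (\<lambda>w. f w + g w) z = pd v f z + pd v g z" for f g :: scalar_field
  by (simp add: pd_add smooth_on_differentiable)

lemma pd_prod: "z \<in> S \<Longrightarrow> smooth_on S f \<Longrightarrow> smooth_on S g \<Longrightarrow>
    pd v (\<lambda>w. f w * g w) z = f z * pd v g z + pd v f z * g z" for f g :: scalar_field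
  by (simp add: pd_mult smooth_on_differentiable)

lemma pd_const: "pd v (\<lambda>w. c) z = 0"
  by (simp add: pd_def)

lemma pd_uminus: "z \<in> S \<Longrightarrow> smooth_on S f \<Longrightarrow> pd v (\<lambda>w. - f w) z = - pd v f z" for f :: scalar_field
  using pd_prod[OF _ smooth_const[of "-1"], of z f v] by (simp add: pd_const)

lemma pd_diff: "z \<in> S \<Longrightarrow> smooth_on S f \<Longrightarrow> smooth_on S g \<Longrightarrow>
    pd v (\<lambda>w. f w - g w) z = pd v f z - pd v g z" for f g :: scalar_field
  using pd_sum[OF _ _ smooth_uminus, of z f g v] by (simp add: pd_uminus)

lemma pd_divide: "z \<in> S \<Longrightarrow> smooth_on S f \<Longrightarrow> pd v (\<lambda>w. f w / c) z = pd v f z / c" for f :: scalar_field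
  using pd_prod[OF _ _ smooth_const[of "inverse c"], of z f v] by (simp add: pd_const divide_inverse)

lemma pd_coord:
  "pd v fst z = fst v" "pd v (\<lambda>w. fst (snd w)) z = fst (snd v)" "pd v (\<lambda>w. snd (snd w)) z = snd (snd v)"
  for z :: point
  by (intro pd_eqI bounded_linear_imp_has_derivative bounded_linear_intros)+

lemma pd_of_time: "z \<in> S \<Longrightarrow> smooth_on (fst ` S) B \<Longrightarrow> pd v (\<lambda>w. B (fst w)) z = fst v * deriv B (fst z)"
  for B :: "real \<Rightarrow> real"
proof -
  assume "z \<in> S" "smooth_on (fst ` S) B"
  then have "B field_differentiable (at (fst z))"
    using smooth_on_differentiable[of "fst ` S" B "fst z"] by (simp add: field_differentiable_def real_differentiable_def)
  then have "(B has_derivative (*) (deriv B (fst z))) (at (fst z))"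
    using DERIV_deriv_iff_field_differentiable has_field_derivative_def by blast
  from pd_eqI[OF has_derivative_compose[OF bounded_linear_imp_has_derivative[OF bounded_linear_fst] this]]
  show ?thesis by (simp add: mult.commute)
qed

lemmas pd_rules = pd_sum pd_prod pd_const pd_uminus pd_diff pd_divide pd_coord pd_of_time

text \<open>As a congruence rule this supplies \<open>w \<in> S\<close> under a derivative, where the conditional rules need it.\<close>

lemmas local_cong = pd_cong[OF open_S]

section \<open>Coordinate partial derivatives and their normal order\<close>

abbreviation "D\<^sub>t \<equiv> pd (1, 0, 0 :: real)"
abbreviation "D\<^sub>x \<equiv> pd (0, 1, 0)"
abbreviation "D\<^sub>y \<equiv> pd (0, 0, 1)"

text \<open>A partial derivative is the derivative along an affine line through \<open>z\<close>
  with velocity \<open>v\<close>; one use of the chain rule covers all three.\<close>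

lemma partials:
  assumes "z \<in> S" "smooth_on S f"
  shows "Dt f z = D\<^sub>t f z" "Dx f z = D\<^sub>x f z" "Dy f z = D\<^sub>y f z"
proof -
  obtain t x y where z: "z = (t, x, y)" by (cases z)
  have *: "deriv (\<lambda>r. f (l r)) r0 = pd v f z" if "(l has_derivative (\<lambda>k. k *\<^sub>R v)) (at r0)" "l r0 = z" for l r0 v
  proof -
    have D: "(f has_derivative (\<lambda>v. pd v f z)) (at (l r0))"
      using assms that smooth_on_has_derivative by blast
    have "(\<lambda>k. pd (k *\<^sub>R v) f z) = (*) (pd v f z)"
      using linear_scale[OF has_derivative_linear[OF D]] by (auto simp: mult.commute)
    with has_derivative_compose[OF that(1) D] show ?thesis
      by (simp add: has_field_derivative_def DERIV_imp_deriv)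
  qed
  have "((\<lambda>r. (r, x, y)) has_derivative (\<lambda>k. k *\<^sub>R (1, 0, 0))) (at t)"
    "((\<lambda>r. (t, r, y)) has_derivative (\<lambda>k. k *\<^sub>R (0, 1, 0))) (at x)"
    "((\<lambda>r. (t, x, r)) has_derivative (\<lambda>k. k *\<^sub>R (0, 0, 1))) (at y)"
    by simp_all (intro has_derivative_Pair has_derivative_const has_derivative_ident)+
  then show "Dt f z = D\<^sub>t f z" "Dx f z = D\<^sub>x f z" "Dy f z = D\<^sub>y f z"
    using * by (simp_all add: z Dt_def Dx_def Dy_def)
qed

text \<open>Oriented so that every jet is rewritten to the form \<open>D\<^sub>t (\<dots> (D\<^sub>x (\<dots> (D\<^sub>y f))))\<close>.\<close>

lemma pd_swap:
  fixes f :: scalar_field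
  assumes "z \<in> S" "smooth_on S f"
  shows "D\<^sub>x (D\<^sub>t f) z = D\<^sub>t (D\<^sub>x f) z" "D\<^sub>y (D\<^sub>t f) z = D\<^sub>t (D\<^sub>y f) z" "D\<^sub>y (D\<^sub>x f) z = D\<^sub>x (D\<^sub>y f) z"
  using assms open_S pd_commute by blast+

lemma smooth_partials:
  assumes "smooth_on S f"
  shows "smooth_on S (Dt f)" "smooth_on S (Dx f)" "smooth_on S (Dy f)"
proof -
  have "smooth_on S g" if "\<And>z. z \<in> S \<Longrightarrow> g z = pd v f z" for g v
    using smooth_on_pd[OF assms, of v] C_on_cong[OF open_S that] unfolding smooth_on_def by simp
  then show "smooth_on S (Dt f)" "smooth_on S (Dx f)" "smooth_on S (Dy f)"
    using partials[OF _ assms] by blast+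
qed

lemma pd_decompose:
  fixes f :: scalar_field
  assumes "z \<in> S" "smooth_on S f"
  shows "pd v f z = fst v * D\<^sub>t f z + fst (snd v) * D\<^sub>x f z + snd (snd v) * D\<^sub>y f z"
proof -
  interpret linear "\<lambda>v. pd v f z"
    using smooth_on_has_derivative[OF assms(2,1)] by (rule has_derivative_linear)
  have "v = fst v *\<^sub>R (1, 0, 0) + (fst (snd v) *\<^sub>R (0, 1, 0) + snd (snd v) *\<^sub>R (0, 0, 1))"
    by (cases v) simp
  then have "pd v f z = pd (fst v *\<^sub>R (1, 0, 0) + (fst (snd v) *\<^sub>R (0, 1, 0) + snd (snd v) *\<^sub>R (0, 0, 1))) f z"
    by simp
  also have "\<dots> = fst v * D\<^sub>t f z + fst (snd v) * D\<^sub>x f z + snd (snd v) * D\<^sub>y f z"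
    unfolding add scale by simp
  finally show ?thesis .
qed

text \<open>The exterior derivative of this form is the divergence times the volume form dt dx dy:
  the three products are taken in cyclic order, so every sign is plus.\<close>

lemma closed_combination:
  assumes f: "smooth_on S f" "smooth_on S g" "smooth_on S h"
    and div: "\<And>z. z \<in> S \<Longrightarrow> Dt f z + Dx g z + Dy h z = 0"
  shows "closed_form S (\<lambda>z v w. f z * wedge dx dy z v w + g z * wedge dy dt z v w + h z * wedge dt dx z v w)"
  unfolding closed_form_def
proof (intro ballI allI)
  fix z v\<^sub>0 v\<^sub>1 v\<^sub>2 assume z: "z \<in> S"
  \<comment> \<open>On constant vector fields the wedge products are constants \<open>a\<close>,
    \<open>b\<close>, \<open>c\<close>, so only the coefficients are differentiated.\<close>
  have *: "frechet_derivative (\<lambda>z. f z * a + g z * b + h z * c) (at z) v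
      = (fst v * D\<^sub>t f z + fst (snd v) * D\<^sub>x f z + snd (snd v) * D\<^sub>y f z) * a
      + (fst v * D\<^sub>t g z + fst (snd v) * D\<^sub>x g z + snd (snd v) * D\<^sub>y g z) * b
      + (fst v * D\<^sub>t h z + fst (snd v) * D\<^sub>x h z + snd (snd v) * D\<^sub>y h z) * c" for v a b c
  proof -
    have "pd v (\<lambda>z. f z * a + g z * b + h z * c) z = pd v f z * a + pd v g z * b + pd v h z * c"
      using z f by (simp add: smooth_rules pd_rules)
    then show ?thesis
      using pd_decompose[OF z f(1), of v] pd_decompose[OF z f(2), of v] pd_decompose[OF z f(3), of v]
      by (simp add: pd_def)
  qed
  \<comment> \<open>Eliminating this derivative leaves a polynomial identity in the components of
    the three vectors.\<close>
  have h: "D\<^sub>y h z = - D\<^sub>t f z - D\<^sub>x g z"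
    using div[OF z] partials[OF z] f by simp
  show "ext_deriv (\<lambda>z v w. f z * wedge dx dy z v w + g z * wedge dy dt z v w + h z * wedge dt dx z v w) z v\<^sub>0 v\<^sub>1 v\<^sub>2 = 0"
    unfolding ext_deriv_def wedge_def dt_def dx_def dy_def * h by (simp add: algebra_simps)
qed

section \<open>The divergence\<close>

text \<open>Together with \<open>local_cong\<close> these rules expand an expression into a
  polynomial in coordinates and ordered partial derivatives, so that ring normalisation can
  finish.\<close>

lemmas jets = smooth_rules smooth_partials partials pd_rules pd_swap DD_def JJ_def

lemma smooth_K:
  assumes "smooth_on S u" "smooth_on S q" "smooth_on S p"
  shows "smooth_on S (K1 u q p)" "smooth_on S (K2 u q p)"
  using assms unfolding K1_def K2_def DD_def by (simp_all add: smooth_rules smooth_partials)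

text \<open>Green's formula for L and its adjoint: \<open>K1\<close> and \<open>K2\<close> are the
  fluxes produced by integrating by parts.\<close>

lemma divergence:
  assumes z: "z \<in> S" and u: "smooth_on S u" and q: "smooth_on S q" and p: "smooth_on S p"
  shows "Dt (\<lambda>w. DD q w * p w) z + Dx (K1 u q p) z + Dy (K2 u q p) z
    = p z * linearised u q z + q z * adjoint_linearised u p z"
  using assms unfolding K1_def K2_def linearised_def adjoint_linearised_def
  by (simp add: jets cong: local_cong) (simp add: algebra_simps)

lemma adjoint_linearised_p0:
  assumes z: "z \<in> S" and u: "smooth_on S u" and s: "smooth_on S s"
    and euler: "euler_eq S u" and cov: "covering_eqs S \<epsilon> l \<mu> u s"
  shows "adjoint_linearised u (p0 \<epsilon> l \<mu> u s) z = 0"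
proof -
  have e: "D\<^sub>t (D\<^sub>x (D\<^sub>y u)) z = D\<^sub>x u z * D\<^sub>x (D\<^sub>y (D\<^sub>y u)) z - D\<^sub>y u z * D\<^sub>x (D\<^sub>x (D\<^sub>y u)) z"
    using euler z u unfolding euler_eq_def by (simp add: jets cong: local_cong)
  have st: "D\<^sub>t s w = JJ u s w + \<epsilon> * EE u w" if "w \<in> S" for w
    using cov that partials[OF that s] by (simp add: covering_eqs_def)
  have "D\<^sub>y (D\<^sub>x (D\<^sub>t s)) z = D\<^sub>y (D\<^sub>x (\<lambda>w. JJ u s w + \<epsilon> * EE u w)) z"
    by (intro local_cong z st)
  \<comment> \<open>D(E(u)) = E(D(u)) + 2 D(u), since D lowers the degree of homogeneity by two.
    This is the source of the constant 2 \<epsilon> in \<open>p0\<close>; the second covering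
    equation then cancels E(D(u)).\<close>
  then have "D\<^sub>t (D\<^sub>x (D\<^sub>y s)) z = D\<^sub>y (D\<^sub>x (JJ u s)) z + \<epsilon> * (EE (DD u) z + 2 * DD u z)"
    using z u s unfolding EE_def split_beta by (simp add: jets cong: local_cong)
  then have "DD (Dt s) z - DD (JJ u s) z + JJ (DD u) s z = l + (\<mu> + 2 * \<epsilon>) * DD u z"
    using cov z u s unfolding covering_eqs_def by (simp add: jets algebra_simps cong: local_cong)
  \<comment> \<open>For t x y, D commutes with J(., x y), so only the time derivative survives and
    yields 1. For t u, the Euler equation \<open>e\<close> cancels the terms carrying t and D(u)
    remains.\<close>
  then show ?thesis
    using z u s e unfolding adjoint_linearised_def p0_def EE_def split_beta
    by (simp add: jets cong: local_cong) (simp add: algebra_simps)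
qed

text \<open>The generators are, in order: scaling of time, time translation, the hyperbolic rotation
  of the plane, its version with angle proportional to t, scaling of the plane, translations in x
  and in y by functions of t, and addition of a function of t to u.\<close>

lemma linearised_symmetries:
  assumes z: "z \<in> S" and u: "smooth_on S u" and A: "smooth_on (fst ` S) A" and euler: "euler_eq S u"
    and q: "q \<in> {phi1 u, phi2 u, phi3 u, phi4 u, phi5 u, phi6 A u, phi7 A u, phi8 A}"
  shows "linearised u q z = 0"
proof -
  have e: "D\<^sub>t (D\<^sub>x (D\<^sub>y u)) w = D\<^sub>x u w * D\<^sub>x (D\<^sub>y (D\<^sub>y u)) w - D\<^sub>y u w * D\<^sub>x (D\<^sub>x (D\<^sub>y u)) w"
    if "w \<in> S" for w
    using euler that u unfolding euler_eq_def by (simp add: jets cong: local_cong)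
  \<comment> \<open>The symmetries contain first derivatives of u, so their linearised equations
    involve first derivatives of the Euler equation, available because it holds on an open
    set.\<close>
  have "pd v (D\<^sub>t (D\<^sub>x (D\<^sub>y u))) z = pd v (\<lambda>w. D\<^sub>x u w * D\<^sub>x (D\<^sub>y (D\<^sub>y u)) w - D\<^sub>y u w * D\<^sub>x (D\<^sub>x (D\<^sub>y u)) w) z" for v
    by (intro local_cong z e)
  from this[of "(1, 0, 0)"] this[of "(0, 1, 0)"] this[of "(0, 0, 1)"] e[OF z] show ?thesis
    using q z u A unfolding linearised_def phi1_def phi2_def phi3_def phi4_def phi5_def phi6_def phi7_def phi8_def split_beta
    by (elim insertE emptyE; simp add: jets cong: local_cong) (simp_all add: algebra_simps)
qed

end

theorem mainTheorem1:
  fixes S :: "(real \<times> real \<times> real) set"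
    and u s q p :: "real \<times> real \<times> real \<Rightarrow> real"
    and A :: "real \<Rightarrow> real"
    and \<epsilon> l \<mu> :: real
  assumes "open S"
    and "smooth_on S u"
    and "smooth_on S s"
    and "smooth_on (fst ` S) A"
    and "euler_eq S u"
    and "covering_eqs S \<epsilon> l \<mu> u s"
    and "q \<in> {phi1 u, phi2 u, phi3 u, phi4 u, phi5 u, phi6 A u, phi7 A u, phi8 A}"
    and "p = p0 \<epsilon> l \<mu> u s"
  shows "closed_form S (Omega u q p) \<and>
    (\<forall>z\<in>S. Dt (\<lambda>w. DD q w * p w) z + Dx (K1 u q p) z + Dy (K2 u q p) z = 0)"
proof -
  interpret open_domain S
    by unfold_locales (rule assms)
  have q: "smooth_on S q"
    using assms(2,4,7)
    unfolding phi1_def phi2_def phi3_def phi4_def phi5_def phi6_def phi7_def phi8_def split_beta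
    by (auto simp: smooth_rules smooth_partials)
  have p: "smooth_on S p"
    using assms(2,3) unfolding assms(8) p0_def split_beta by (simp add: smooth_rules)
  have div: "Dt (\<lambda>w. DD q w * p w) z + Dx (K1 u q p) z + Dy (K2 u q p) z = 0" if z: "z \<in> S" for z
    unfolding divergence[OF z assms(2) q p] linearised_symmetries[OF z assms(2,4,5,7)]
      adjoint_linearised_p0[OF z assms(2,3,5,6), folded assms(8)] by simp
  have "smooth_on S (\<lambda>w. DD q w * p w)"
    using q p unfolding DD_def by (simp add: smooth_rules smooth_partials)
  \<comment> \<open>\<open>Omega\<close> is this combination of basic 2-forms, so the vanishing
    divergence gives its closedness.\<close>
  from closed_combination[OF this smooth_K[OF assms(2) q p] div] have "closed_form S (Omega u q p)"
    unfolding Omega_def[abs_def] .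
  with div show ?thesis by blast
qed

end
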